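(* Let $\tau$ be an uncountable cardinal, let $\Sigma=\Sigma\mathbb Z_2^\tau$, and let $L$ be a countable subgroup of $P\mathbb Z_2^\tau$. Then the subgroup $G_L=\Sigma+L$ of $P\mathbb Z_2^\tau$ (with the subspace topology) is not reflexive.
   Context: $\mathbb T=\{z\in\mathbb C:|z|=1\}$ is the circle group. For a topological Abelian group $G$, $G^\wedge$ is the group of continuous characters (continuous homomorphisms $G\to\mathbb T$) with the topology of uniform convergence on compact subsets of $G$. $G$ is reflexive if the evaluation homomorphism $\alpha_G:G\to G^{\wedge\wedge}$, $\alpha_G(x)(\chi)=\chi(x)$, is a topological isomorphism of $G$ onto $G^{\wedge\wedge}=(G^\wedge)^\wedge$. For a topological group $H$, $PH$ ($P$-modification) is the same group with the finer group topology whose base consists of all $G_\delta$-sets of $H$. $\mathbb Z_2=\{0,1\}$ is the discrete two-element group, $\mathbb Z_2^\tau$ carries the Tychonoff product topology, and $P\mathbb Z_2^\tau$ is its $P$-modification. For $x\in\mathbb Z_2^\tau$, $\operatorname{supp}(x)=\{i\in\tau: x(i)\neq 0\}$, and $\Sigma\mathbb Z_2^\tau=\{x\in\mathbb Z_2^\tau:|\operatorname{supp}(x)|\le\omega\}$. *)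

theory Defs
  imports "HOL-Analysis.Analysis" "HOL-Algebra.Elementary_Groups" "HOL-Algebra.Product_Groups"
begin

text \<open>
  A topological Abelian group is represented by a pair of a group \<open>G\<close> and a topology \<open>X\<close> on
  \<open>carrier G\<close> (so \<open>topspace X = carrier G\<close>).
\<close>

definition circle_group :: "complex monoid" where
  "circle_group = \<lparr>carrier = sphere 0 1, monoid.mult = (*), one = 1\<rparr>"

definition circle_topology :: "complex topology" where
  "circle_topology = top_of_set (sphere 0 1)"

text \<open>
  Characters are taken to be extensional (\<open>undefined\<close> outside \<open>carrier G\<close>), so that equality of
  characters is equality on \<open>carrier G\<close>.
\<close>

definition characters :: "('a, 'b) monoid_scheme \<Rightarrow> 'a topology \<Rightarrow> ('a \<Rightarrow> complex) set" where
  "characters G X =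
     {\<phi> \<in> extensional (carrier G). \<phi> \<in> hom G circle_group \<and> continuous_map X circle_topology \<phi>}"

definition dual_group :: "('a, 'b) monoid_scheme \<Rightarrow> 'a topology \<Rightarrow> ('a \<Rightarrow> complex) monoid" where
  "dual_group G X =
     \<lparr>carrier = characters G X,
      monoid.mult = (\<lambda>\<phi> \<psi>. \<lambda>x\<in>carrier G. \<phi> x \<otimes>\<^bsub>circle_group\<^esub> \<psi> x),
      one = (\<lambda>x\<in>carrier G. \<one>\<^bsub>circle_group\<^esub>)\<rparr>"

text \<open>Uniform convergence on compact subsets:\<close>

definition dual_topology :: "('a, 'b) monoid_scheme \<Rightarrow> 'a topology \<Rightarrow> ('a \<Rightarrow> complex) topology" where
  "dual_topology G X = topology (\<lambda>U. U \<subseteq> characters G X \<and>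
     (\<forall>\<phi>\<in>U. \<exists>K \<epsilon>. compactin X K \<and> 0 < \<epsilon> \<and>
        {\<psi> \<in> characters G X. \<forall>x\<in>K. dist (\<psi> x) (\<phi> x) < \<epsilon>} \<subseteq> U))"

lemma openin_dual_topology:
  "openin (dual_topology G X) U \<longleftrightarrow> U \<subseteq> characters G X \<and>
     (\<forall>\<phi>\<in>U. \<exists>K \<epsilon>. compactin X K \<and> 0 < \<epsilon> \<and>
        {\<psi> \<in> characters G X. \<forall>x\<in>K. dist (\<psi> x) (\<phi> x) < \<epsilon>} \<subseteq> U)"
proof -
  define N where "N K \<epsilon> \<phi> = {\<psi> \<in> characters G X. \<forall>x\<in>K. dist (\<psi> x) (\<phi> x) < \<epsilon>}"
    for K \<epsilon> and \<phi> :: "'a \<Rightarrow> complex"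
  define P where "P U \<longleftrightarrow> U \<subseteq> characters G X \<and>
     (\<forall>\<phi>\<in>U. \<exists>K \<epsilon>. compactin X K \<and> 0 < \<epsilon> \<and> N K \<epsilon> \<phi> \<subseteq> U)" for U
  have "P (S \<inter> T)" if S: "P S" and T: "P T" for S T
    unfolding P_def
  proof (intro conjI ballI)
    show "S \<inter> T \<subseteq> characters G X"
      using S by (auto simp: P_def)
    fix \<phi> assume "\<phi> \<in> S \<inter> T"
    then obtain K \<epsilon> K' \<epsilon>' where "compactin X K" "0 < \<epsilon>" "N K \<epsilon> \<phi> \<subseteq> S"
        "compactin X K'" "0 < \<epsilon>'" "N K' \<epsilon>' \<phi> \<subseteq> T"
      using S T by (auto simp: P_def) metis
    moreover have "N (K \<union> K') (min \<epsilon> \<epsilon>') \<phi> \<subseteq> N K \<epsilon> \<phi> \<inter> N K' \<epsilon>' \<phi>"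
      by (auto simp: N_def)
    ultimately show "\<exists>K \<epsilon>. compactin X K \<and> 0 < \<epsilon> \<and> N K \<epsilon> \<phi> \<subseteq> S \<inter> T"
      by (intro exI[of _ "K \<union> K'"] exI[of _ "min \<epsilon> \<epsilon>'"]) (auto intro: compactin_Un)
  qed
  moreover have "P (\<Union>\<U>)" if \<U>: "\<forall>S\<in>\<U>. P S" for \<U>
    unfolding P_def
  proof (intro conjI ballI)
    show "\<Union>\<U> \<subseteq> characters G X"
      using \<U> by (auto simp: P_def)
    fix \<phi> assume "\<phi> \<in> \<Union>\<U>"
    then obtain S where S: "S \<in> \<U>" "\<phi> \<in> S" by blast
    then obtain K \<epsilon> where "compactin X K" "0 < \<epsilon>" "N K \<epsilon> \<phi> \<subseteq> S"
      using \<U> unfolding P_def by meson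
    with S show "\<exists>K \<epsilon>. compactin X K \<and> 0 < \<epsilon> \<and> N K \<epsilon> \<phi> \<subseteq> \<Union>\<U>" by blast
  qed
  ultimately have "istopology P"
    by (simp add: istopology_def)
  then have "openin (topology P) U \<longleftrightarrow> P U"
    by (simp add: topology_inverse')
  moreover have "dual_topology G X = topology P"
    by (simp add: dual_topology_def P_def[abs_def] N_def)
  ultimately show ?thesis
    by (simp add: P_def N_def)
qed

lemma topspace_dual_topology [simp]: "topspace (dual_topology G X) = characters G X"
proof
  show "topspace (dual_topology G X) \<subseteq> characters G X"
    using openin_topspace[of "dual_topology G X"] unfolding openin_dual_topology by blast
  have "openin (dual_topology G X) (characters G X)"
    unfolding openin_dual_topology
    by (auto intro!: exI[of _ "{}"] exI[of _ "1::real"])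
  then show "characters G X \<subseteq> topspace (dual_topology G X)"
    by (rule openin_subset)
qed

abbreviation bidual_group ::
    "('a, 'b) monoid_scheme \<Rightarrow> 'a topology \<Rightarrow> (('a \<Rightarrow> complex) \<Rightarrow> complex) monoid" where
  "bidual_group G X \<equiv> dual_group (dual_group G X) (dual_topology G X)"

abbreviation bidual_topology ::
    "('a, 'b) monoid_scheme \<Rightarrow> 'a topology \<Rightarrow> (('a \<Rightarrow> complex) \<Rightarrow> complex) topology" where
  "bidual_topology G X \<equiv> dual_topology (dual_group G X) (dual_topology G X)"

definition evaluation_map ::
    "('a, 'b) monoid_scheme \<Rightarrow> 'a topology \<Rightarrow> 'a \<Rightarrow> ('a \<Rightarrow> complex) \<Rightarrow> complex" where
  "evaluation_map G X = (\<lambda>x\<in>carrier G. \<lambda>\<phi>\<in>characters G X. \<phi> x)"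

definition reflexive_group :: "('a, 'b) monoid_scheme \<Rightarrow> 'a topology \<Rightarrow> bool" where
  "reflexive_group G X \<longleftrightarrow>
     evaluation_map G X \<in> iso G (bidual_group G X) \<and>
     homeomorphic_map X (bidual_topology G X) (evaluation_map G X)"

definition P_modification :: "'a topology \<Rightarrow> 'a topology" where
  "P_modification X = topology (arbitrary union_of gdelta_in X)"

lemma openin_P_modification:
  "openin (P_modification X) = arbitrary union_of gdelta_in X"
  unfolding P_modification_def
  by (intro topology_inverse' istopology_base gdelta_in_Int)

definition Z2_power :: "'i set \<Rightarrow> ('i \<Rightarrow> int) monoid" where
  "Z2_power I = product_group I (\<lambda>_. integer_mod_group 2)"

definition Z2_power_topology :: "'i set \<Rightarrow> ('i \<Rightarrow> int) topology" where
  "Z2_power_topology I =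
     product_topology (\<lambda>_. discrete_topology (carrier (integer_mod_group 2))) I"

lemma topspace_Z2_power_topology [simp]:
  "topspace (Z2_power_topology I) = carrier (Z2_power I)"
  by (simp add: Z2_power_topology_def Z2_power_def)

definition supp :: "'i set \<Rightarrow> ('i \<Rightarrow> int) \<Rightarrow> 'i set" where
  "supp I x = {i \<in> I. x i \<noteq> 0}"

definition Sigma_product :: "'i set \<Rightarrow> ('i \<Rightarrow> int) set" where
  "Sigma_product I = {x \<in> carrier (Z2_power I). countable (supp I x)}"

text \<open>
  \<open><#>\<close> is the elementwise product of subsets of a group; \<open>Z2_power I\<close> is written
  multiplicatively, so this is the sum \<open>\<Sigma> + L\<close>.
\<close>

definition Sigma_plus :: "'i set \<Rightarrow> ('i \<Rightarrow> int) set \<Rightarrow> ('i \<Rightarrow> int) monoid" where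
  "Sigma_plus I L = (Z2_power I)\<lparr>carrier := Sigma_product I <#>\<^bsub>Z2_power I\<^esub> L\<rparr>"

definition Sigma_plus_topology :: "'i set \<Rightarrow> ('i \<Rightarrow> int) set \<Rightarrow> ('i \<Rightarrow> int) topology" where
  "Sigma_plus_topology I L =
     subtopology (P_modification (Z2_power_topology I)) (carrier (Sigma_plus I L))"

end

theory Submission
  imports Defs
begin

text \<open>
  Already the continuity of the evaluation map fails. Compact subsets of \<open>\<Sigma> + L\<close> are finite, so the
  dual carries the topology of pointwise convergence, and it suffices to find a compact set of
  characters that is not equicontinuous. Split \<open>I\<close> into uncountably many disjoint countably infinite
  blocks. On each block the trace of \<open>L\<close> is a proper subgroup, so some nonzero functional \<open>\<phi>\<^sub>j\<close>
  annihilates it. These functionals combine into a homomorphism \<open>S\<close> from \<open>\<Sigma> + L\<close> to the ring of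
  countable sets of indices (with symmetric difference and intersection) that vanishes on \<open>L\<close>. The
  ring homomorphisms from that ring to the two-element field form a compact space, since they are
  cut out by pointwise equations; such a homomorphism is either zero or determined by the
  intersection with a fixed countable set, so its composition with \<open>S\<close> is a continuous character.
  The family contains every \<open>\<phi>\<^sub>j\<close>, hence is not trivial on any neighbourhood of the identity.
\<close>

subsection \<open>Additive functionals on sets\<close>

text \<open>Under symmetric difference, sets form a vector space over the two-element field, with
  \<open>M\<close> as a subspace. Zorn's lemma gives a subspace \<open>N\<close> maximal among those
  that contain \<open>M\<close> and miss \<open>v\<close>. It has index two, and
  \<open>\<phi>\<close> is the quotient map, true exactly off \<open>N\<close>.\<close>

lemma additive_functional_separating:
  fixes M :: "'a set set"
  assumes M: "\<And>A B. A \<in> M \<Longrightarrow> B \<in> M \<Longrightarrow> sym_diff A B \<in> M"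
    and v: "v \<notin> M" and empty: "{} \<in> M"
  shows "\<exists>\<phi>. (\<forall>A B. \<phi> (sym_diff A B) \<longleftrightarrow> \<phi> A \<noteq> \<phi> B) \<and> (\<forall>A\<in>M. \<not> \<phi> A) \<and> \<phi> v"
proof -
  define \<N> where "\<N> = {N. M \<subseteq> N \<and> v \<notin> N \<and> (\<forall>A\<in>N. \<forall>B\<in>N. sym_diff A B \<in> N)}"
  have "M \<in> \<N>"
    using M v by (auto simp: \<N>_def)
  moreover have "\<Union>\<C> \<in> \<N>" if ne: "\<C> \<noteq> {}" and ch: "subset.chain \<N> \<C>" for \<C>
  proof -
    have sub: "\<C> \<subseteq> \<N>"
      using ch by (simp add: subset_chain_def)
    have "sym_diff A B \<in> \<Union>\<C>" if AB: "A \<in> \<Union>\<C>" "B \<in> \<Union>\<C>" for A B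
    proof -
      obtain N N' where N: "N \<in> \<C>" "A \<in> N" and N': "N' \<in> \<C>" "B \<in> N'"
        using AB by blast
      have "N \<subseteq> N' \<or> N' \<subseteq> N"
        using ch N(1) N'(1) by (simp add: subset_chain_def)
      then have "sym_diff A B \<in> N \<or> sym_diff A B \<in> N'"
        using sub N N' unfolding \<N>_def by (metis (no_types, lifting) mem_Collect_eq subsetD)
      with N N' show ?thesis by blast
    qed
    moreover have "M \<subseteq> \<Union>\<C>" "v \<notin> \<Union>\<C>"
      using ne sub unfolding \<N>_def by blast+
    ultimately show ?thesis
      unfolding \<N>_def by blast
  qed
  ultimately obtain N where N: "N \<in> \<N>" and max: "\<And>X. X \<in> \<N> \<Longrightarrow> N \<subseteq> X \<Longrightarrow> X = N"
    using subset_Zorn_nonempty[of \<N>] by blast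
  have cl: "sym_diff A B \<in> N" if "A \<in> N" "B \<in> N" for A B
    using N that by (auto simp: \<N>_def)
  have "v \<notin> N" "M \<subseteq> N"
    using N by (auto simp: \<N>_def)
  \<comment> \<open>\<open>N\<close> has index two: enlarging it by any \<open>A \<notin> N\<close> must capture \<open>v\<close>.\<close>
  have coset: "sym_diff A v \<in> N" if A: "A \<notin> N" for A
  proof -
    \<comment> \<open>The union of \<open>N\<close> and its coset by \<open>A\<close>, that is, the
      subspace spanned by \<open>N\<close> and \<open>A\<close>.\<close>
    define N' where "N' = {X. X \<in> N \<or> sym_diff A X \<in> N}"
    have "{} \<in> N"
      using empty \<open>M \<subseteq> N\<close> by blast
    then have "A \<in> N'"
      by (simp add: N'_def)
    have "sym_diff X Y \<in> N'" if "X \<in> N'" "Y \<in> N'" for X Y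
    proof -
      have "sym_diff A (sym_diff X Y) = sym_diff X (sym_diff A Y)"
        "sym_diff A (sym_diff X Y) = sym_diff (sym_diff A X) Y"
        "sym_diff X Y = sym_diff (sym_diff A X) (sym_diff A Y)"
        by blast+
      with that show ?thesis
        unfolding N'_def mem_Collect_eq by (metis cl)
    qed
    moreover have "N \<subseteq> N'"
      by (auto simp: N'_def)
    ultimately have "N' \<in> \<N>" if "v \<notin> N'"
      using that \<open>M \<subseteq> N\<close> unfolding \<N>_def by simp
    then have "v \<in> N'"
      using max[of N'] \<open>N \<subseteq> N'\<close> \<open>A \<in> N'\<close> A by metis
    then show ?thesis
      using \<open>v \<notin> N\<close> by (simp add: N'_def)
  qed
  have "sym_diff A B \<notin> N \<longleftrightarrow> (A \<notin> N) \<noteq> (B \<notin> N)" for A B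
  proof -
    \<comment> \<open>The first two identities handle the case where \<open>A\<close> or
      \<open>B\<close> lies in \<open>N\<close>. If neither does, both lie in the coset of
      \<open>v\<close>, and the third identity cancels \<open>v\<close>.\<close>
    have "sym_diff A (sym_diff A B) = B" "sym_diff (sym_diff A B) B = A"
      "sym_diff (sym_diff A v) (sym_diff B v) = sym_diff A B"
      by blast+
    then show ?thesis
      using cl coset by metis
  qed
  with \<open>v \<notin> N\<close> \<open>M \<subseteq> N\<close> show ?thesis
    by (intro exI[of _ "\<lambda>A. A \<notin> N"]) auto
qed

text \<open>Cantor's diagonal set. It is needed because the traces of \<open>L\<close> on a block
  form such a countable \<open>M\<close>.\<close>

lemma countable_sets_miss_set:
  fixes M :: "nat set set"
  assumes "countable M"
  obtains v where "v \<notin> M"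
proof -
  have "{n. n \<notin> from_nat_into M n} \<notin> M"
  proof
    assume "{n. n \<notin> from_nat_into M n} \<in> M"
    then obtain k where "from_nat_into M k = {n. n \<notin> from_nat_into M n}"
      using from_nat_into_surj[OF assms] by blast
    then show False by blast
  qed
  then show thesis by (rule that)
qed

subsection \<open>Ring homomorphisms on countable sets\<close>

lemma openin_discrete_cylinder:
  assumes "finite A" "z \<in> (\<Pi>\<^sub>E i\<in>I. D)"
  shows "openin (product_topology (\<lambda>_. discrete_topology D) I)
           {y \<in> \<Pi>\<^sub>E i\<in>I. D. \<forall>i\<in>A \<inter> I. y i = z i}"
proof -
  have "{y \<in> \<Pi>\<^sub>E i\<in>I. D. \<forall>i\<in>A \<inter> I. y i = z i} = (\<Pi>\<^sub>E i\<in>I. if i \<in> A then {z i} else D)"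
    using assms(2) by (auto simp: PiE_iff extensional_def split: if_splits)
  moreover have "finite {i \<in> I. (if i \<in> A then {z i} else D) \<noteq> D}"
    by (rule finite_subset[OF _ assms(1)]) auto
  ultimately show ?thesis
    using assms(2) by (auto simp: openin_PiE_gen PiE_iff)
qed

text \<open>
  Restrictions to the ring of countable sets are meant; the values of \<open>F\<close> on uncountable sets are
  unconstrained.
\<close>

definition ring_functionals :: "('a set \<Rightarrow> bool) set" where
  "ring_functionals = {F. \<forall>C D. countable C \<longrightarrow> countable D \<longrightarrow>
     (F (sym_diff C D) \<longleftrightarrow> F C \<noteq> F D) \<and> (F (C \<inter> D) \<longleftrightarrow> F C \<and> F D)}"

text \<open>Failure of the equations at a pair \<open>C\<close>, \<open>D\<close> is visible from
  four values of \<open>F\<close>, hence an open condition. The functionals are thus closed in a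
  compact cube.\<close>

lemma compactin_ring_functionals:
  "compactin (product_topology (\<lambda>_. discrete_topology UNIV) UNIV) ring_functionals"
proof (rule closedin_compact_space)
  show "compact_space (product_topology (\<lambda>_::'a set. discrete_topology (UNIV :: bool set)) UNIV)"
    by (simp add: compact_space_product_topology compact_space_discrete_topology)
  show "closedin (product_topology (\<lambda>_. discrete_topology UNIV) UNIV)
          (ring_functionals :: ('a set \<Rightarrow> bool) set)"
    unfolding closedin_def
  proof (intro conjI)
    show "openin (product_topology (\<lambda>_. discrete_topology UNIV) UNIV)
        (topspace (product_topology (\<lambda>_. discrete_topology UNIV) UNIV) -
          (ring_functionals :: ('a set \<Rightarrow> bool) set))"
    proof (subst openin_subopen, intro ballI)
      fix F :: "'a set \<Rightarrow> bool"
      assume "F \<in> topspace (product_topology (\<lambda>_. discrete_topology UNIV) UNIV) -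
                ring_functionals"
      then obtain C D where CD: "countable C" "countable D"
          "\<not> ((F (sym_diff C D) \<longleftrightarrow> F C \<noteq> F D) \<and> (F (C \<inter> D) \<longleftrightarrow> F C \<and> F D))"
        by (auto simp: ring_functionals_def)
      define U where "U = {F' \<in> \<Pi>\<^sub>E i\<in>(UNIV :: 'a set set). (UNIV :: bool set).
        \<forall>i\<in>{sym_diff C D, C, D, C \<inter> D} \<inter> UNIV. F' i = F i}"
      have "openin (product_topology (\<lambda>_. discrete_topology UNIV) UNIV) U"
        unfolding U_def by (rule openin_discrete_cylinder) auto
      moreover have "F \<in> U"
        by (simp add: U_def)
      moreover have "U \<inter> ring_functionals = {}"
        using CD by (auto simp: U_def ring_functionals_def)
      ultimately show "\<exists>T. openin (product_topology (\<lambda>_. discrete_topology UNIV) UNIV) T \<and>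
          F \<in> T \<and> T \<subseteq> topspace (product_topology (\<lambda>_. discrete_topology UNIV) UNIV) -
                ring_functionals"
        by (intro exI[of _ U]) auto
    qed
  qed simp
qed

section \<open>The compact set of characters\<close>

text \<open>The composition of \<open>F\<close> with \<open>S\<close>, with the two-element field
  identified with the subgroup {1, -1} of the circle.\<close>

definition sign_character ::
    "('a, 'c) monoid_scheme \<Rightarrow> ('a \<Rightarrow> 'b set) \<Rightarrow> ('b set \<Rightarrow> bool) \<Rightarrow> 'a \<Rightarrow> complex" where
  "sign_character G S F = (\<lambda>x\<in>carrier G. if F (S x) then -1 else 1)"

text \<open>By \<open>fin\<close> the dual carries the topology of pointwise convergence. The value
  at \<open>x\<close> reads \<open>F\<close> only at the argument \<open>S x\<close>, so passing
  from functionals to characters is continuous and preserves compactness.\<close>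

lemma compactin_sign_characters:
  fixes S :: "'a \<Rightarrow> 'b set"
  assumes char: "\<And>F. F \<in> ring_functionals \<Longrightarrow> sign_character G S F \<in> characters G X"
    and fin: "\<And>C. compactin X C \<Longrightarrow> finite C" and top: "topspace X \<subseteq> carrier G"
  shows "compactin (dual_topology G X) (sign_character G S ` ring_functionals)"
proof -
  let ?P = "product_topology (\<lambda>_::'b set. discrete_topology (UNIV :: bool set)) UNIV"
  have "continuous_map (subtopology ?P ring_functionals) (dual_topology G X) (sign_character G S)"
    unfolding continuous_map_def
  proof (intro conjI allI impI)
    show "sign_character G S \<in> topspace (subtopology ?P ring_functionals) \<rightarrow>
        topspace (dual_topology G X)"
      using char by auto
    fix U assume U: "openin (dual_topology G X) U"
    show "openin (subtopology ?P ring_functionals)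
        {F \<in> topspace (subtopology ?P ring_functionals). sign_character G S F \<in> U}"
    proof (subst openin_subopen, intro ballI)
      fix F assume "F \<in> {F \<in> topspace (subtopology ?P ring_functionals). sign_character G S F \<in> U}"
      then have F: "F \<in> ring_functionals" "sign_character G S F \<in> U" by auto
      obtain C e where C: "compactin X C" and e: "0 < e" and
        sub: "{\<psi> \<in> characters G X. \<forall>x\<in>C. dist (\<psi> x) (sign_character G S F x) < e} \<subseteq> U"
        using U F(2) unfolding openin_dual_topology by blast
      \<comment> \<open>Fixing \<open>F\<close> on the finitely many sets \<open>S x\<close> with
        \<open>x\<close> in \<open>C\<close> fixes the character on \<open>C\<close> exactly,
        whatever \<open>e\<close> is.\<close>
      define V where "V = {F' \<in> \<Pi>\<^sub>E i\<in>(UNIV :: 'b set set). (UNIV :: bool set).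
        \<forall>i\<in>(S ` C) \<inter> UNIV. F' i = F i}"
      have "openin ?P V"
        unfolding V_def by (rule openin_discrete_cylinder) (auto intro: fin C)
      moreover have "F \<in> V" by (simp add: V_def)
      moreover have "sign_character G S F' \<in> U" if "F' \<in> V" "F' \<in> ring_functionals" for F'
      proof -
        have "sign_character G S F' x = sign_character G S F x" if "x \<in> C" for x
          using \<open>F' \<in> V\<close> that by (simp add: sign_character_def V_def restrict_def)
        with e char[OF that(2)] show ?thesis
          by (intro subsetD[OF sub]) auto
      qed
      ultimately show "\<exists>T. openin (subtopology ?P ring_functionals) T \<and> F \<in> T \<and>
          T \<subseteq> {F \<in> topspace (subtopology ?P ring_functionals). sign_character G S F \<in> U}"
        using F(1) by (intro exI[of _ "V \<inter> ring_functionals"]) (auto simp: openin_subtopology)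
    qed
  qed
  moreover have "compactin (subtopology ?P ring_functionals) ring_functionals"
    using compactin_ring_functionals by (simp add: compactin_subtopology)
  ultimately show ?thesis
    by (rule image_compactin[rotated])
qed

subsection \<open>The groups \<open>\<Sigma> + L\<close>\<close>

lemma carrier_Z2_power: "carrier (Z2_power I) = (\<Pi>\<^sub>E i\<in>I. {0..<2})"
  by (simp add: Z2_power_def carrier_integer_mod_group)

lemma mult_Z2_power: "x \<otimes>\<^bsub>Z2_power I\<^esub> y = (\<lambda>i\<in>I. (x i + y i) mod 2)"
  by (simp add: Z2_power_def)

lemma one_Z2_power: "\<one>\<^bsub>Z2_power I\<^esub> = (\<lambda>i\<in>I. 0)"
  by (simp add: Z2_power_def)

lemma comm_group_Z2_power: "comm_group (Z2_power I)"
proof (rule group.group_comm_groupI)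
  show "group (Z2_power I)" by (simp add: Z2_power_def)
qed (simp add: mult_Z2_power add.commute)

lemma supp_mult:
  assumes "x \<in> carrier (Z2_power I)" "y \<in> carrier (Z2_power I)"
  shows "supp I (x \<otimes>\<^bsub>Z2_power I\<^esub> y) = sym_diff (supp I x) (supp I y)"
proof -
  have "(x i + y i) mod 2 \<noteq> 0 \<longleftrightarrow> (x i \<noteq> 0) \<noteq> (y i \<noteq> 0)" if "i \<in> I" for i
  proof -
    have "x i \<in> {0..<2}" "y i \<in> {0..<2}"
      using assms that by (auto simp: carrier_Z2_power)
    then have "x i = 0 \<or> x i = 1" "y i = 0 \<or> y i = 1" by auto
    then show ?thesis by auto
  qed
  then show ?thesis
    unfolding mult_Z2_power supp_def by auto
qed

lemma subgroup_Sigma_product: "subgroup (Sigma_product I) (Z2_power I)"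
proof -
  interpret comm_group "Z2_power I" by (rule comm_group_Z2_power)
  have inv: "inv\<^bsub>Z2_power I\<^esub> x = x" if "x \<in> carrier (Z2_power I)" for x
  proof (rule inv_equality[OF _ that that])
    have "(x i + x i) mod 2 = 0" for i by presburger
    then show "x \<otimes>\<^bsub>Z2_power I\<^esub> x = \<one>\<^bsub>Z2_power I\<^esub>"
      by (simp add: mult_Z2_power one_Z2_power)
  qed
  show ?thesis
  proof
    show "x \<otimes>\<^bsub>Z2_power I\<^esub> y \<in> Sigma_product I"
      if "x \<in> Sigma_product I" "y \<in> Sigma_product I" for x y
      using that by (auto simp: Sigma_product_def supp_mult)
    show "\<one>\<^bsub>Z2_power I\<^esub> \<in> Sigma_product I"
      by (auto simp: Sigma_product_def) (simp add: one_Z2_power supp_def)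
  qed (auto simp: Sigma_product_def inv)
qed

lemma subgroup_Sigma_plus:
  assumes "subgroup L (Z2_power I)"
  shows "subgroup (carrier (Sigma_plus I L)) (Z2_power I)"
proof -
  interpret comm_group "Z2_power I" by (rule comm_group_Z2_power)
  show ?thesis
    using mult_subgroups[OF subgroup_Sigma_product assms] by (simp add: Sigma_plus_def)
qed

lemma Sigma_product_subset_Sigma_plus:
  assumes "subgroup L (Z2_power I)"
  shows "Sigma_product I \<subseteq> carrier (Sigma_plus I L)"
proof
  interpret comm_group "Z2_power I" by (rule comm_group_Z2_power)
  fix x assume x: "x \<in> Sigma_product I"
  then have "x \<in> carrier (Z2_power I)" by (simp add: Sigma_product_def)
  then have "x = x \<otimes>\<^bsub>Z2_power I\<^esub> \<one>\<^bsub>Z2_power I\<^esub>" by simp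
  with x subgroup.one_closed[OF assms] show "x \<in> carrier (Sigma_plus I L)"
    unfolding Sigma_plus_def set_mult_def by auto
qed

section \<open>The topology of the P-modification on Sigma + L\<close>

lemma topspace_P_modification [simp]: "topspace (P_modification X) = topspace X"
proof
  show "topspace (P_modification X) \<subseteq> topspace X"
    using openin_topspace[of "P_modification X"] gdelta_in_subset
    unfolding openin_P_modification union_of_def arbitrary_def by fastforce
  show "topspace X \<subseteq> topspace (P_modification X)"
    by (intro openin_subset) (simp add: openin_P_modification arbitrary_union_of_inc)
qed

lemma topspace_Sigma_plus_topology:
  assumes "subgroup L (Z2_power I)"
  shows "topspace (Sigma_plus_topology I L) = carrier (Sigma_plus I L)"
  using subgroup.subset[OF subgroup_Sigma_plus[OF assms]]
  by (auto simp: Sigma_plus_topology_def)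

lemma gdelta_in_countable_cylinder:
  assumes "countable A" "z \<in> carrier (Z2_power I)"
  shows "gdelta_in (Z2_power_topology I) {y \<in> carrier (Z2_power I). \<forall>i\<in>A \<inter> I. y i = z i}"
proof -
  define V where "V i = {y \<in> carrier (Z2_power I). \<forall>i\<in>{i} \<inter> I. y i = z i}" for i
  have "openin (Z2_power_topology I) (V i)" for i
    using openin_discrete_cylinder[of "{i}" z I "{0..<2}"] assms(2)
    unfolding V_def Z2_power_topology_def carrier_Z2_power by (simp add: carrier_integer_mod_group)
  \<comment> \<open>Inserting the whole space keeps the family nonempty when \<open>A\<close> is
    empty.\<close>
  then have "gdelta_in (Z2_power_topology I) (\<Inter>(insert (carrier (Z2_power I)) (V ` A)))"
    using assms(1) gdelta_in_topspace[of "Z2_power_topology I"]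
    by (intro gdelta_in_Inter) (auto intro: open_imp_gdelta_in)
  also have "\<Inter>(insert (carrier (Z2_power I)) (V ` A)) =
      {y \<in> carrier (Z2_power I). \<forall>i\<in>A \<inter> I. y i = z i}"
    by (auto simp: V_def)
  finally show ?thesis .
qed

text \<open>A G-delta set around \<open>z\<close> is a countable intersection of open sets, each
  containing a cylinder on finitely many coordinates; together these use countably many. All later
  topological arguments on the group go through this description.\<close>

lemma openin_Sigma_plus_topology:
  assumes L: "subgroup L (Z2_power I)"
  shows "openin (Sigma_plus_topology I L) U \<longleftrightarrow> U \<subseteq> carrier (Sigma_plus I L) \<and>
    (\<forall>z\<in>U. \<exists>A. countable A \<and> {y \<in> carrier (Sigma_plus I L). \<forall>i\<in>A \<inter> I. y i = z i} \<subseteq> U)"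
    (is "?lhs \<longleftrightarrow> ?rhs")
proof
  have sub: "carrier (Sigma_plus I L) \<subseteq> carrier (Z2_power I)"
    by (rule subgroup.subset[OF subgroup_Sigma_plus[OF L]])
  show ?rhs if ?lhs
  proof (intro conjI ballI)
    show "U \<subseteq> carrier (Sigma_plus I L)"
      using openin_subset[OF that] topspace_Sigma_plus_topology[OF L] by simp
    fix z assume z: "z \<in> U"
    obtain W where W: "openin (P_modification (Z2_power_topology I)) W"
        "U = W \<inter> carrier (Sigma_plus I L)"
      using \<open>?lhs\<close> unfolding Sigma_plus_topology_def openin_subtopology by blast
    then obtain S where S: "gdelta_in (Z2_power_topology I) S" "z \<in> S" "S \<subseteq> W"
      using z unfolding openin_P_modification arbitrary_union_of_alt by blast
    obtain O' where O': "\<And>n::nat. openin (Z2_power_topology I) (O' n)" "\<Inter>(range O') = S"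
      using S(1) unfolding gdelta_in_descending by blast
    have "\<exists>B. finite B \<and> {y \<in> carrier (Z2_power I). \<forall>i\<in>B \<inter> I. y i = z i} \<subseteq> O' n" for n
    proof -
      have "z \<in> O' n" using S(2) O'(2) by blast
      then obtain V where V: "finite {i \<in> I. V i \<noteq> {0..<2}}" "z \<in> Pi\<^sub>E I V" "Pi\<^sub>E I V \<subseteq> O' n"
        using O'(1)[of n] unfolding Z2_power_topology_def openin_product_topology_alt
        by (auto simp: carrier_integer_mod_group)
      have "{y \<in> carrier (Z2_power I). \<forall>i\<in>{i \<in> I. V i \<noteq> {0..<2}} \<inter> I. y i = z i} \<subseteq> Pi\<^sub>E I V"
      proof
        fix y assume y: "y \<in> {y \<in> carrier (Z2_power I).
            \<forall>i\<in>{i \<in> I. V i \<noteq> {0..<2}} \<inter> I. y i = z i}"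
        have "y i \<in> V i" if "i \<in> I" for i
        proof (cases "V i = {0..<2}")
          case True
          have "y i \<in> {0..<2}" using y that by (auto simp: carrier_Z2_power)
          with True show ?thesis by simp
        next
          case False
          then have "y i = z i" using y that by auto
          then show ?thesis using V(2) that by auto
        qed
        with y show "y \<in> Pi\<^sub>E I V" by (auto simp: carrier_Z2_power PiE_iff)
      qed
      with V show ?thesis by blast
    qed
    then have "\<exists>B. \<forall>n. finite (B n) \<and>
        {y \<in> carrier (Z2_power I). \<forall>i\<in>B n \<inter> I. y i = z i} \<subseteq> O' n"
      by (intro choice allI)
    then obtain B where B: "\<And>n. finite (B n)"
        "\<And>n. {y \<in> carrier (Z2_power I). \<forall>i\<in>B n \<inter> I. y i = z i} \<subseteq> O' n"
      by auto
    have "countable (\<Union>n. B n)"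
      using B(1) by (auto intro: countable_finite)
    moreover have "{y \<in> carrier (Sigma_plus I L). \<forall>i\<in>(\<Union>n. B n) \<inter> I. y i = z i} \<subseteq> U"
      using B(2) O'(2) S(3) W(2) sub by fast
    ultimately show "\<exists>A. countable A \<and>
        {y \<in> carrier (Sigma_plus I L). \<forall>i\<in>A \<inter> I. y i = z i} \<subseteq> U"
      by blast
  qed
  show ?lhs if rhs: ?rhs
  proof (subst openin_subopen, intro ballI)
    fix z assume z: "z \<in> U"
    then obtain A where A: "countable A"
        "{y \<in> carrier (Sigma_plus I L). \<forall>i\<in>A \<inter> I. y i = z i} \<subseteq> U"
      using rhs by blast
    have zc: "z \<in> carrier (Sigma_plus I L)" using rhs z by blast
    have "openin (P_modification (Z2_power_topology I))
        {y \<in> carrier (Z2_power I). \<forall>i\<in>A \<inter> I. y i = z i}"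
      unfolding openin_P_modification
      using zc sub by (intro arbitrary_union_of_inc gdelta_in_countable_cylinder A(1)) auto
    then have "openin (Sigma_plus_topology I L)
        ({y \<in> carrier (Z2_power I). \<forall>i\<in>A \<inter> I. y i = z i} \<inter> carrier (Sigma_plus I L))"
      unfolding Sigma_plus_topology_def openin_subtopology by blast
    also have "{y \<in> carrier (Z2_power I). \<forall>i\<in>A \<inter> I. y i = z i} \<inter> carrier (Sigma_plus I L) =
        {y \<in> carrier (Sigma_plus I L). \<forall>i\<in>A \<inter> I. y i = z i}"
      using sub by blast
    finally have "openin (Sigma_plus_topology I L)
        {y \<in> carrier (Sigma_plus I L). \<forall>i\<in>A \<inter> I. y i = z i}" .
    then show "\<exists>T. openin (Sigma_plus_topology I L) T \<and> z \<in> T \<and> T \<subseteq> U"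
      using A(2) zc by (intro exI conjI) auto
  qed
qed

text \<open>This reduces uniform convergence on compact sets to pointwise convergence. It holds
  because countably many points can be separated by countably many coordinates.\<close>

lemma compactin_Sigma_plus_topology_finite:
  assumes L: "subgroup L (Z2_power I)" and K: "compactin (Sigma_plus_topology I L) K"
  shows "finite K"
proof (rule ccontr)
  assume "infinite K"
  then obtain C where C: "C \<subseteq> K" "countable C" "infinite C"
    by (meson infinite_countable_subset')
  have sub: "carrier (Sigma_plus I L) \<subseteq> carrier (Z2_power I)"
    by (rule subgroup.subset[OF subgroup_Sigma_plus[OF L]])
  have KG: "K \<subseteq> carrier (Sigma_plus I L)"
    using compactin_subset_topspace[OF K] by (simp add: topspace_Sigma_plus_topology[OF L])
  have "\<exists>i\<in>I. x i \<noteq> y i" if "x \<in> C" "y \<in> C" "x \<noteq> y" for x y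
  proof -
    have "x \<in> extensional I" "y \<in> extensional I"
      using that C(1) KG sub unfolding carrier_Z2_power by (meson PiE_ext PiE_iff subsetD)+
    with that(3) show ?thesis by (meson extensionalityI)
  qed
  then obtain d where d: "\<And>x y. x \<in> C \<Longrightarrow> y \<in> C \<Longrightarrow> x \<noteq> y \<Longrightarrow> d x y \<in> I \<and> x (d x y) \<noteq> y (d x y)"
    by metis
  \<comment> \<open>The coordinates in \<open>A\<close> separate the points of \<open>C\<close>, so each open coset \<open>N z\<close> below contains
    at most one of them.\<close>
  define A where "A = (\<Union>x\<in>C. \<Union>y\<in>C. {d x y})"
  have "countable A" unfolding A_def using C(2) by auto
  define N where "N z = {y \<in> carrier (Sigma_plus I L). \<forall>i\<in>A \<inter> I. y i = z i}" for z
  have "openin (Sigma_plus_topology I L) (N z)" for z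
    unfolding openin_Sigma_plus_topology[OF L] N_def using \<open>countable A\<close> by fastforce
  moreover have "K \<subseteq> \<Union>(N ` K)"
    using KG by (auto simp: N_def)
  ultimately obtain \<F> where \<F>: "finite \<F>" "\<F> \<subseteq> N ` K" "K \<subseteq> \<Union>\<F>"
    using K unfolding compactin_def by (metis (no_types, lifting) imageE)
  have "finite (C \<inter> N z)" for z
  proof -
    have "x = y" if "x \<in> C \<inter> N z" "y \<in> C \<inter> N z" for x y
    proof (rule ccontr)
      assume "x \<noteq> y"
      then have "d x y \<in> A \<inter> I" "x (d x y) \<noteq> y (d x y)"
        using d that by (auto simp: A_def)
      with that show False by (auto simp: N_def)
    qed
    then have "C \<inter> N z \<subseteq> {x}" if "x \<in> C \<inter> N z" for x
      using that by blast
    then show ?thesis by (metis finite.simps finite_subset equals0I)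
  qed
  then have "finite (\<Union>U\<in>\<F>. C \<inter> U)"
    using \<F>(1,2) by (intro finite_UN_I) auto
  moreover have "C \<subseteq> (\<Union>U\<in>\<F>. C \<inter> U)"
    using C(1) \<F>(3) by blast
  ultimately show False
    using C(3) finite_subset by blast
qed

section \<open>Continuity of the characters\<close>

text \<open>Each \<open>R j\<close> is a countable set of coordinates deciding whether
  \<open>j\<close> lies in \<open>S x\<close>. Although \<open>S x\<close> as a whole may involve
  uncountably many coordinates, multiplicativity of \<open>F\<close> reduces the character to
  countably many.\<close>

lemma sign_character_in_characters:
  fixes S :: "('i \<Rightarrow> int) \<Rightarrow> 'b set"
  assumes L: "subgroup L (Z2_power I)"
    and cnt: "\<And>x. x \<in> carrier (Sigma_plus I L) \<Longrightarrow> countable (S x)"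
    and add: "\<And>x y. x \<in> carrier (Sigma_plus I L) \<Longrightarrow> y \<in> carrier (Sigma_plus I L) \<Longrightarrow>
                S (x \<otimes>\<^bsub>Z2_power I\<^esub> y) = sym_diff (S x) (S y)"
    and loc: "\<And>j x y. (\<And>i. i \<in> R j \<inter> I \<Longrightarrow> x i = y i) \<Longrightarrow> j \<in> S x \<longleftrightarrow> j \<in> S y"
    and R: "\<And>j. countable (R j)"
    and F: "F \<in> ring_functionals"
  shows "sign_character (Sigma_plus I L) S F
           \<in> characters (Sigma_plus I L) (Sigma_plus_topology I L)"
  unfolding characters_def
proof (intro CollectI conjI)
  let ?G = "Sigma_plus I L" and ?\<kappa> = "sign_character (Sigma_plus I L) S F"
  have mult: "x \<otimes>\<^bsub>?G\<^esub> y = x \<otimes>\<^bsub>Z2_power I\<^esub> y" for x y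
    by (simp add: Sigma_plus_def)
  have closed: "x \<otimes>\<^bsub>Z2_power I\<^esub> y \<in> carrier ?G" if "x \<in> carrier ?G" "y \<in> carrier ?G" for x y
    using that by (rule subgroup.m_closed[OF subgroup_Sigma_plus[OF L]])
  have Fadd: "F (sym_diff C D) \<longleftrightarrow> F C \<noteq> F D" and Fint: "F (C \<inter> D) \<longleftrightarrow> F C \<and> F D"
    if "countable C" "countable D" for C D
    using F that by (auto simp: ring_functionals_def)
  show "?\<kappa> \<in> extensional (carrier ?G)"
    by (simp add: sign_character_def)
  show "?\<kappa> \<in> hom ?G circle_group"
    by (intro homI) (auto simp: sign_character_def circle_group_def mult closed add Fadd cnt)
  \<comment> \<open>If \<open>F C\<close> holds for a countable \<open>C\<close>, then \<open>F D = F (D \<inter> C)\<close>, so only the coordinates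
    in \<open>\<Union>j\<in>C. R j\<close> matter.\<close>
  have "\<exists>A. countable A \<and> (\<forall>x\<in>carrier ?G. \<forall>y\<in>carrier ?G.
      (\<forall>i\<in>A \<inter> I. x i = y i) \<longrightarrow> ?\<kappa> x = ?\<kappa> y)"
  proof (cases "\<exists>C. countable C \<and> F C")
    case True
    then obtain C where C: "countable C" "F C" by blast
    have eq_\<kappa>: "?\<kappa> x = ?\<kappa> y" if x: "x \<in> carrier ?G" and y: "y \<in> carrier ?G"
      and eq: "\<And>i. i \<in> (\<Union>j\<in>C. R j) \<inter> I \<Longrightarrow> x i = y i" for x y
    proof -
      have "j \<in> S x \<longleftrightarrow> j \<in> S y" if "j \<in> C" for j
        using that by (intro loc eq) auto
      then have "S x \<inter> C = S y \<inter> C" by blast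
      then have "F (S x) = F (S y)"
        using Fint[OF cnt[OF x] C(1)] Fint[OF cnt[OF y] C(1)] C(2) by simp
      then show ?thesis using x y by (simp add: sign_character_def)
    qed
    show ?thesis
    proof (intro exI[of _ "\<Union>j\<in>C. R j"] conjI ballI impI)
      show "countable (\<Union>j\<in>C. R j)"
        using C(1) R by (rule countable_UN)
      show "?\<kappa> x = ?\<kappa> y" if "x \<in> carrier ?G" "y \<in> carrier ?G"
        "\<forall>i\<in>(\<Union>j\<in>C. R j) \<inter> I. x i = y i" for x y
        using that by (intro eq_\<kappa>) blast+
    qed
  next
    \<comment> \<open>Here \<open>F\<close> vanishes on all countable sets, so the character is
      constantly 1.\<close>
    case False
    then have "?\<kappa> x = ?\<kappa> y" if "x \<in> carrier ?G" "y \<in> carrier ?G" for x y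
      using that cnt by (auto simp: sign_character_def)
    then show ?thesis by (intro exI[of _ "{}"]) blast
  qed
  then obtain A where A: "countable A"
    "\<And>x y. x \<in> carrier ?G \<Longrightarrow> y \<in> carrier ?G \<Longrightarrow> (\<forall>i\<in>A \<inter> I. x i = y i) \<Longrightarrow> ?\<kappa> x = ?\<kappa> y"
    by blast
  show "continuous_map (Sigma_plus_topology I L) circle_topology ?\<kappa>"
    unfolding continuous_map_def
  proof (intro conjI allI impI)
    show "?\<kappa> \<in> topspace (Sigma_plus_topology I L) \<rightarrow> topspace circle_topology"
      by (auto simp: topspace_Sigma_plus_topology[OF L] circle_topology_def sign_character_def)
    \<comment> \<open>The character is locally constant, so the preimage of an arbitrary set
      \<open>U\<close> is open.\<close>
    fix U
    show "openin (Sigma_plus_topology I L) {x \<in> topspace (Sigma_plus_topology I L). ?\<kappa> x \<in> U}"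
      unfolding openin_Sigma_plus_topology[OF L] topspace_Sigma_plus_topology[OF L]
    proof (intro conjI ballI)
      fix z assume z: "z \<in> {x \<in> carrier ?G. ?\<kappa> x \<in> U}"
      have "{y \<in> carrier ?G. \<forall>i\<in>A \<inter> I. y i = z i} \<subseteq> {x \<in> carrier ?G. ?\<kappa> x \<in> U}"
      proof
        fix y assume y: "y \<in> {y \<in> carrier ?G. \<forall>i\<in>A \<inter> I. y i = z i}"
        then have "?\<kappa> y = ?\<kappa> z"
          using z by (intro A(2)) blast+
        with y z show "y \<in> {x \<in> carrier ?G. ?\<kappa> x \<in> U}" by simp
      qed
      with A(1) show "\<exists>A. countable A \<and>
          {y \<in> carrier ?G. \<forall>i\<in>A \<inter> I. y i = z i} \<subseteq> {x \<in> carrier ?G. ?\<kappa> x \<in> U}"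
        by blast
    qed auto
  qed
qed

section \<open>Open annihilators in the bidual\<close>

text \<open>By \<open>sq\<close>, characters of the dual take only the values 1 and -1 on
  \<open>K\<close>. These are at distance 2, so a uniform error below 1 on \<open>K\<close> already
  forces equality.\<close>

lemma openin_bidual_annihilator:
  assumes K: "compactin (dual_topology G X) K" and one: "\<one>\<^bsub>dual_group G X\<^esub> \<in> characters G X"
    and sq: "\<And>\<phi>. \<phi> \<in> K \<Longrightarrow> \<phi> \<otimes>\<^bsub>dual_group G X\<^esub> \<phi> = \<one>\<^bsub>dual_group G X\<^esub>"
  shows "openin (bidual_topology G X)
    {\<xi> \<in> characters (dual_group G X) (dual_topology G X). \<forall>\<phi>\<in>K. \<xi> \<phi> = 1}"
    (is "openin _ ?W")
  unfolding openin_dual_topology[of "dual_group G X"]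
proof (intro conjI ballI)
  let ?D = "dual_group G X"
  have KD: "K \<subseteq> carrier ?D"
    using compactin_subset_topspace[OF K] by (simp add: dual_group_def)
  have oneD: "\<one>\<^bsub>?D\<^esub> \<in> carrier ?D"
    using one by (simp add: dual_group_def)
  have pm: "\<xi> \<phi> = 1 \<or> \<xi> \<phi> = -1"
    if \<xi>: "\<xi> \<in> characters ?D (dual_topology G X)" and \<phi>: "\<phi> \<in> K" for \<xi> \<phi>
  proof -
    have hom: "\<xi> \<in> hom ?D circle_group"
      using \<xi> by (simp add: characters_def)
    then have mult: "\<xi> (a \<otimes>\<^bsub>?D\<^esub> b) = \<xi> a * \<xi> b" if "a \<in> carrier ?D" "b \<in> carrier ?D" for a b
      using hom_mult[OF hom that] by (simp add: circle_group_def)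
    have "\<one>\<^bsub>?D\<^esub> \<otimes>\<^bsub>?D\<^esub> \<one>\<^bsub>?D\<^esub> = \<one>\<^bsub>?D\<^esub>"
      by (auto simp: dual_group_def circle_group_def)
    \<comment> \<open>The value at the unit is idempotent and nonzero, hence 1.\<close>
    with mult[OF oneD oneD] have "\<xi> \<one>\<^bsub>?D\<^esub> = \<xi> \<one>\<^bsub>?D\<^esub> * \<xi> \<one>\<^bsub>?D\<^esub>" by simp
    moreover have "\<xi> \<one>\<^bsub>?D\<^esub> \<noteq> 0"
      using hom_in_carrier[OF hom oneD] by (auto simp: circle_group_def)
    ultimately have "\<xi> \<one>\<^bsub>?D\<^esub> = 1" by simp
    then have "\<xi> \<phi> * \<xi> \<phi> = 1"
      using mult[of \<phi> \<phi>] sq[OF \<phi>] \<phi> KD by auto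
    then show ?thesis
      by (simp add: square_eq_1_iff)
  qed
  fix \<xi> assume \<xi>: "\<xi> \<in> ?W"
  have "{\<psi> \<in> characters ?D (dual_topology G X). \<forall>\<phi>\<in>K. dist (\<psi> \<phi>) (\<xi> \<phi>) < 1} \<subseteq> ?W"
  proof
    fix \<psi> assume \<psi>: "\<psi> \<in> {\<psi> \<in> characters ?D (dual_topology G X). \<forall>\<phi>\<in>K. dist (\<psi> \<phi>) (\<xi> \<phi>) < 1}"
    have "\<psi> \<phi> = 1" if "\<phi> \<in> K" for \<phi>
    proof -
      have "dist (\<psi> \<phi>) 1 < 1" using \<psi> \<xi> that by fastforce
      moreover have "dist (- 1) (1::complex) = 2" by (simp add: dist_norm)
      ultimately show ?thesis using pm[of \<psi> \<phi>] \<psi> that by auto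
    qed
    with \<psi> show "\<psi> \<in> ?W" by blast
  qed
  with K show "\<exists>K' \<epsilon>. compactin (dual_topology G X) K' \<and> 0 < \<epsilon> \<and>
      {\<psi> \<in> characters ?D (dual_topology G X). \<forall>\<phi>\<in>K'. dist (\<psi> \<phi>) (\<xi> \<phi>) < \<epsilon>} \<subseteq> ?W"
    using zero_less_one by blast
qed auto

text \<open>Since \<open>I\<close> is equipotent to its product with \<open>nat\<close>, it splits
  into blocks indexed by \<open>I\<close> itself; \<open>f i\<close> enumerates block
  \<open>i\<close>.\<close>

lemma infinite_disjoint_sequences:
  includes cardinal_syntax
  assumes "infinite I"
  obtains f :: "'i \<Rightarrow> nat \<Rightarrow> 'i"
  where "\<And>i n. i \<in> I \<Longrightarrow> f i n \<in> I"
    "\<And>i j n m. i \<in> I \<Longrightarrow> j \<in> I \<Longrightarrow> f i n = f j m \<Longrightarrow> i = j \<and> n = m"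
proof -
  have "|UNIV :: nat set| \<le>o |I|"
    using assms by (simp add: infinite_iff_card_of_nat)
  then have "|I \<times> (UNIV :: nat set)| =o |I|"
    using assms by (intro card_of_Times_infinite_simps) auto
  then obtain g where g: "bij_betw g (I \<times> (UNIV :: nat set)) I"
    using card_of_ordIso by blast
  show thesis
  proof
    show "g (i, n) \<in> I" if "i \<in> I" for i n
      using bij_betwE[OF g] that by blast
    show "i = j \<and> n = m" if "i \<in> I" "j \<in> I" "g (i, n) = g (j, m)" for i j n m
      using inj_onD[OF bij_betw_imp_inj_on[OF g] that(3)] that(1,2) by simp
  qed
qed

section \<open>Discontinuity of the evaluation map\<close>

theorem theorem2:
  fixes I :: "'i set" and L :: "('i \<Rightarrow> int) set"
  assumes "uncountable I"
    and "subgroup L (Z2_power I)"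
    and "countable L"
  shows "\<not> reflexive_group (Sigma_plus I L) (Sigma_plus_topology I L)"
proof
  assume refl: "reflexive_group (Sigma_plus I L) (Sigma_plus_topology I L)"
  let ?Z = "Z2_power I" and ?G = "Sigma_plus I L" and ?X = "Sigma_plus_topology I L"
  note L = \<open>subgroup L ?Z\<close>
  have sub: "carrier ?G \<subseteq> carrier ?Z"
    by (rule subgroup.subset[OF subgroup_Sigma_plus[OF L]])
  have "infinite I"
    using assms(1) countable_finite by blast
  then obtain f :: "'i \<Rightarrow> nat \<Rightarrow> 'i" where fI: "\<And>i n. i \<in> I \<Longrightarrow> f i n \<in> I"
    and finj: "\<And>i j n m. i \<in> I \<Longrightarrow> j \<in> I \<Longrightarrow> f i n = f j m \<Longrightarrow> i = j \<and> n = m"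
    using infinite_disjoint_sequences by metis
  \<comment> \<open>The part of the support of \<open>x\<close> in block \<open>i\<close>, read as a
    subset of \<open>nat\<close> through the enumeration \<open>f i\<close>.\<close>
  define trace where "trace i x = f i -` supp I x" for i x
  have trace_mult: "trace i (x \<otimes>\<^bsub>?Z\<^esub> y) = sym_diff (trace i x) (trace i y)"
    if "x \<in> carrier ?Z" "y \<in> carrier ?Z" for i x y
    unfolding trace_def supp_mult[OF that] by auto

  \<comment> \<open>The traces of \<open>L\<close> form a countable, hence proper, subspace of the
    subsets of \<open>nat\<close>, so some nonzero functional kills them.\<close>
  have "\<exists>\<phi>. (\<forall>A B. \<phi> (sym_diff A B) \<longleftrightarrow> \<phi> A \<noteq> \<phi> B) \<and> (\<forall>l\<in>L. \<not> \<phi> (trace i l)) \<and> (\<exists>v. \<phi> v)" for i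
  proof -
    have "sym_diff A B \<in> trace i ` L" if AB: "A \<in> trace i ` L" "B \<in> trace i ` L" for A B
    proof -
      obtain a b where ab: "a \<in> L" "b \<in> L" "A = trace i a" "B = trace i b"
        using AB by blast
      have "trace i (a \<otimes>\<^bsub>?Z\<^esub> b) = sym_diff A B"
        unfolding ab(3,4) using ab(1,2) subgroup.subset[OF L] by (intro trace_mult) auto
      then show ?thesis
        using subgroup.m_closed[OF L ab(1,2)] by (metis imageI)
    qed
    moreover obtain v where "v \<notin> trace i ` L"
      by (rule countable_sets_miss_set[OF countable_image[OF assms(3)]])
    moreover have "trace i \<one>\<^bsub>?Z\<^esub> = {}"
      by (simp add: trace_def one_Z2_power supp_def)
    then have "{} \<in> trace i ` L"
      using subgroup.one_closed[OF L] by (metis imageI)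
    ultimately have "\<exists>\<phi>. (\<forall>A B. \<phi> (sym_diff A B) \<longleftrightarrow> \<phi> A \<noteq> \<phi> B) \<and>
        (\<forall>A\<in>trace i ` L. \<not> \<phi> A) \<and> \<phi> v"
      by (rule additive_functional_separating)
    then show ?thesis by auto
  qed
  then obtain \<phi> v where \<phi>: "\<And>i A B. \<phi> i (sym_diff A B) \<longleftrightarrow> \<phi> i A \<noteq> \<phi> i B"
    and \<phi>L: "\<And>i l. l \<in> L \<Longrightarrow> \<not> \<phi> i (trace i l)" and \<phi>v: "\<And>i. \<phi> i (v i)"
    by metis
  have \<phi>_empty: "\<not> \<phi> i {}" for i
    using \<phi>[of i "{}" "{}"] by simp

  define S where "S x = {i \<in> I. \<phi> i (trace i x)}" for x
  have S_mult: "S (x \<otimes>\<^bsub>?Z\<^esub> y) = sym_diff (S x) (S y)"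
    if "x \<in> carrier ?Z" "y \<in> carrier ?Z" for x y
    using that by (auto simp: S_def trace_mult \<phi>)
  \<comment> \<open>The blocks are disjoint, so choosing a point of \<open>C\<close> in every block
    that meets \<open>C\<close> is injective.\<close>
  have disj: "countable {i \<in> I. \<exists>n. f i n \<in> C}" if "countable C" for C
  proof -
    have "\<exists>g. \<forall>i\<in>{i \<in> I. \<exists>n. f i n \<in> C}. f i (g i) \<in> C"
      by (rule bchoice) blast
    then obtain g where g: "\<And>i. i \<in> {i \<in> I. \<exists>n. f i n \<in> C} \<Longrightarrow> f i (g i) \<in> C" by blast
    then have "(\<lambda>i. f i (g i)) ` {i \<in> I. \<exists>n. f i n \<in> C} \<subseteq> C" by blast
    moreover have "inj_on (\<lambda>i. f i (g i)) {i \<in> I. \<exists>n. f i n \<in> C}"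
      using finj by (intro inj_onI) blast
    ultimately show ?thesis
      using countable_image_inj_on[OF countable_subset[OF _ that]] by simp
  qed
  \<comment> \<open>Write \<open>x\<close> as \<open>s\<close> plus \<open>l\<close>. The part
    \<open>l\<close> contributes nothing to \<open>S\<close>, and \<open>s\<close> only touches the
    countably many blocks that meet its support.\<close>
  have S_countable: "countable (S x)" if x: "x \<in> carrier ?G" for x
  proof -
    obtain s l where sl: "s \<in> Sigma_product I" "l \<in> L" "x = s \<otimes>\<^bsub>?Z\<^esub> l"
      using x by (auto simp: Sigma_plus_def set_mult_def)
    have "S l = {}"
      using \<phi>L[OF sl(2)] by (simp add: S_def)
    then have "S x = S s"
      using sl S_mult[of s l] subgroup.subset[OF L] by (auto simp: Sigma_product_def)
    moreover have "S s \<subseteq> {i \<in> I. \<exists>n. f i n \<in> supp I s}"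
    proof
      fix i assume i: "i \<in> S s"
      then have "trace i s \<noteq> {}" using \<phi>_empty by (auto simp: S_def)
      with i show "i \<in> {i \<in> I. \<exists>n. f i n \<in> supp I s}" by (auto simp: S_def trace_def)
    qed
    moreover have "countable (supp I s)" using sl(1) by (simp add: Sigma_product_def)
    ultimately show ?thesis
      using countable_subset[OF _ disj[of "supp I s"]] by simp
  qed
  have S_local: "j \<in> S x \<longleftrightarrow> j \<in> S y" if "\<And>i. i \<in> range (f j) \<inter> I \<Longrightarrow> x i = y i" for j x y
  proof -
    have "trace j x = trace j y"
      using that by (auto simp: trace_def supp_def)
    then show ?thesis by (simp add: S_def)
  qed

  let ?K = "sign_character ?G S ` ring_functionals"
  have char: "sign_character ?G S F \<in> characters ?G ?X" if "F \<in> ring_functionals" for F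
  proof (rule sign_character_in_characters[OF L])
    show "countable (S x)" if "x \<in> carrier ?G" for x
      using that by (rule S_countable)
    show "S (x \<otimes>\<^bsub>?Z\<^esub> y) = sym_diff (S x) (S y)"
      if "x \<in> carrier ?G" "y \<in> carrier ?G" for x y
      using that sub by (intro S_mult) blast+
    show "j \<in> S x \<longleftrightarrow> j \<in> S y" if "\<And>i. i \<in> range (f j) \<inter> I \<Longrightarrow> x i = y i" for j x y
      using that by (rule S_local)
    show "countable (range (f j))" for j
      by simp
  qed (rule that)
  have compact: "compactin (dual_topology ?G ?X) ?K"
    using compactin_Sigma_plus_topology_finite[OF L] topspace_Sigma_plus_topology[OF L]
    by (intro compactin_sign_characters char) auto
  \<comment> \<open>The unit of the dual comes from the zero functional, so \<open>char\<close> also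
    shows that it is a character.\<close>
  have one: "\<one>\<^bsub>dual_group ?G ?X\<^esub> = sign_character ?G S (\<lambda>_. False)"
    by (simp add: dual_group_def circle_group_def sign_character_def)
  have "(\<lambda>_. False) \<in> ring_functionals"
    by (simp add: ring_functionals_def)
  then have oneD: "\<one>\<^bsub>dual_group ?G ?X\<^esub> \<in> characters ?G ?X"
    unfolding one by (rule char)
  have sq: "\<psi> \<otimes>\<^bsub>dual_group ?G ?X\<^esub> \<psi> = \<one>\<^bsub>dual_group ?G ?X\<^esub>" if "\<psi> \<in> ?K" for \<psi>
    using that by (auto simp: dual_group_def circle_group_def sign_character_def)
  define W where "W = {\<xi> \<in> characters (dual_group ?G ?X) (dual_topology ?G ?X). \<forall>\<psi>\<in>?K. \<xi> \<psi> = 1}"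
  have openW: "openin (bidual_topology ?G ?X) W"
    unfolding W_def by (rule openin_bidual_annihilator[OF compact oneD sq])
  have cont: "continuous_map ?X (bidual_topology ?G ?X) (evaluation_map ?G ?X)"
    using refl by (simp add: reflexive_group_def homeomorphic_imp_continuous_map)
  \<comment> \<open>The points at which every character of \<open>?K\<close> equals 1. Continuity of
    the evaluation map would make this a neighbourhood of the identity.\<close>
  define V where "V = {x \<in> carrier ?G. evaluation_map ?G ?X x \<in> W}"
  have "openin ?X V"
    using openin_continuous_map_preimage[OF cont openW]
    by (simp add: V_def topspace_Sigma_plus_topology[OF L])
  moreover have one_V: "\<one>\<^bsub>?Z\<^esub> \<in> V"
  proof -
    have oneG: "\<one>\<^bsub>?Z\<^esub> \<in> carrier ?G"
      by (rule subgroup.one_closed[OF subgroup_Sigma_plus[OF L]])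
    have "supp I \<one>\<^bsub>?Z\<^esub> = {}"
      by (simp add: one_Z2_power supp_def)
    then have "S \<one>\<^bsub>?Z\<^esub> = {}"
      using \<phi>_empty by (simp add: S_def trace_def)
    moreover have "\<not> F {}" if "F \<in> ring_functionals" for F :: "'i set \<Rightarrow> bool"
    proof -
      have "F (sym_diff {} {}) \<longleftrightarrow> F {} \<noteq> F {}"
        using that unfolding ring_functionals_def by blast
      then show ?thesis by simp
    qed
    ultimately have "sign_character ?G S F \<one>\<^bsub>?Z\<^esub> = 1" if "F \<in> ring_functionals" for F
      using that oneG by (simp add: sign_character_def)
    then have "\<psi> \<one>\<^bsub>?Z\<^esub> = 1" if "\<psi> \<in> ?K" for \<psi>
      using that by blast
    moreover have "evaluation_map ?G ?X \<one>\<^bsub>?Z\<^esub>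
        \<in> characters (dual_group ?G ?X) (dual_topology ?G ?X)"
      using continuous_map_image_subset_topspace[OF cont] oneG
      by (auto simp: topspace_Sigma_plus_topology[OF L])
    ultimately show ?thesis
      using oneG char by (auto simp: V_def W_def evaluation_map_def)
  qed
  ultimately obtain A where A: "countable A"
      "{y \<in> carrier ?G. \<forall>i\<in>A \<inter> I. y i = \<one>\<^bsub>?Z\<^esub> i} \<subseteq> V"
    unfolding openin_Sigma_plus_topology[OF L] by blast
  \<comment> \<open>The countable set \<open>A\<close> meets only countably many of the uncountably
    many blocks.\<close>
  obtain j where j: "j \<in> I" "\<And>n. f j n \<notin> A"
  proof -
    have "{i \<in> I. \<exists>n. f i n \<in> A} \<noteq> I"
      using disj[OF A(1)] assms(1) by metis
    then show thesis using that by blast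
  qed
  \<comment> \<open>A copy of \<open>v j\<close> placed in block \<open>j\<close>: its support is
    countable, it agrees with the identity on \<open>A\<close>, and the functional
    \<open>\<phi> j\<close> detects it.\<close>
  define y where "y = (\<lambda>i\<in>I. if i \<in> f j ` v j then 1 else 0 :: int)"
  have y: "y \<in> carrier ?Z"
    by (auto simp: y_def carrier_Z2_power)
  have supp_y: "supp I y = f j ` v j"
    using fI[OF j(1)] by (auto simp: supp_def y_def)
  have yG: "y \<in> carrier ?G"
    using y supp_y Sigma_product_subset_Sigma_plus[OF L] by (auto simp: Sigma_product_def)
  have "inj (f j)"
    using finj[OF j(1) j(1)] by (auto intro: injI)
  then have "trace j y = v j"
    by (simp add: trace_def supp_y inj_vimage_image_eq)
  then have "j \<in> S y"
    using \<phi>v j(1) by (simp add: S_def)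
  have "y i = \<one>\<^bsub>?Z\<^esub> i" if "i \<in> A \<inter> I" for i
    using that j(2) by (auto simp: y_def one_Z2_power)
  then have "y \<in> V"
    using A(2) yG by blast
  \<comment> \<open>Evaluation at the index \<open>j\<close> is a ring homomorphism; composed with
    \<open>S\<close> it recovers the functional \<open>\<phi> j\<close> on block
    \<open>j\<close>.\<close>
  define F where "F C \<longleftrightarrow> j \<in> C" for C
  have F: "F \<in> ring_functionals"
    by (auto simp: ring_functionals_def F_def)
  have "sign_character ?G S F y = 1"
    using \<open>y \<in> V\<close> F char[OF F] yG by (auto simp: V_def W_def evaluation_map_def)
  moreover have "sign_character ?G S F y = -1"
    using \<open>j \<in> S y\<close> yG by (simp add: sign_character_def F_def)
  ultimately show False by simp
qed

end
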